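(* Let $\alpha\le1$ and let $f\in\mathfrak{A}_\alpha$ have the Taylor expansion $f(z)=z+\sum_{n=2}^\infty a_nz^n$. For integers $2\le k\le m-1$ denote $$\Lambda_\alpha(m,k):=\frac{(\alpha+(1-\alpha)k)(\alpha+(1-\alpha)(m-k+1))}{2(\alpha+(1-\alpha)m)}.$$ Then $$\left|a_m-\Lambda_\alpha(m,k)a_ka_{m-k+1}\right|+\Lambda_\alpha(m,k)\left|a_ka_{m-k+1}\right|\le\frac{2}{\alpha+(1-\alpha)m}.$$ Consequently, $|a_m|\le\frac{2}{\alpha+(1-\alpha)m}$, and for any $\nu\in\mathbb{C}$, $$\left|a_m-\nu a_ka_{m-k+1}\right|\le\frac{2}{\alpha+(1-\alpha)m}\max\left\{1,\left|1-\frac{\nu}{\Lambda_\alpha(m,k)}\right|\right\}.$$ The first and the last of these inequalities are sharp.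
   Context: Let $\mathbb{D}$ be the open unit disk. $\mathcal{A}$ is the set of holomorphic $f:\mathbb{D}\to\mathbb{C}$ with $f(0)=0$, $f'(0)=1$. For $\alpha\le1$, $$\mathfrak{A}_\alpha=\left\{f\in\mathcal{A}:\ \operatorname{Re}\left[\alpha\frac{f(z)}{z}+(1-\alpha)f'(z)\right]\ge0,\ z\in\mathbb{D}\setminus\{0\}\right\}.$$ Sharp means that for each choice of the parameters there is a function in $\mathfrak{A}_\alpha$ for which equality holds. *)

theory Defs
  imports "HOL-Complex_Analysis.Complex_Analysis"
begin

text \<open>Membership depends only on the values of \<open>f\<close> on the open unit disk; outside it the total
  function \<open>f\<close> is unconstrained.\<close>

definition class_A :: "(complex \<Rightarrow> complex) set" where
  "class_A = {f. f holomorphic_on ball 0 1 \<and> f 0 = 0 \<and> deriv f 0 = 1}"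

definition class_A_alpha :: "real \<Rightarrow> (complex \<Rightarrow> complex) set" where
  "class_A_alpha \<alpha> = {f \<in> class_A. \<forall>z \<in> ball 0 1 - {0}.
     Re (of_real \<alpha> * (f z / z) + of_real (1 - \<alpha>) * deriv f z) \<ge> 0}"

abbreviation taylor_coeff :: "(complex \<Rightarrow> complex) \<Rightarrow> nat \<Rightarrow> complex" where
  "taylor_coeff f n \<equiv> fps_nth (fps_expansion f 0) n"

text \<open>Only meaningful for \<open>k \<le> m\<close>, where the subtraction on \<open>nat\<close> does not truncate.\<close>

definition Lambda :: "real \<Rightarrow> nat \<Rightarrow> nat \<Rightarrow> real" where
  "Lambda \<alpha> m k =
     (\<alpha> + (1 - \<alpha>) * real k) * (\<alpha> + (1 - \<alpha>) * real (m - k + 1)) /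
     (2 * (\<alpha> + (1 - \<alpha>) * real m))"

end

theory Submission
  imports Defs
begin

text \<open>
  Put \<open>p(z) = \<alpha> f(z)/z + (1 - \<alpha>) f'(z)\<close>. Its coefficients are \<open>c\<^sub>n = (\<alpha> + (1 - \<alpha>)(n + 1)) a\<^sub>n\<^sub>+\<^sub>1\<close>, so the claim
  becomes \<open>|c\<^sub>s\<^sub>+\<^sub>t - c\<^sub>s c\<^sub>t / 2| + |c\<^sub>s c\<^sub>t| / 2 \<le> 2\<close> for functions with \<open>p(0) = 1\<close> and nonnegative real part. On
  the circle of radius \<open>r < 1\<close> the density \<open>Re p / (2 pi)\<close> is a probability density, for which
  \<open>X = e\<^sup>-\<^sup>i\<^sup>s\<^sup>\<theta>\<close>, \<open>Y = e\<^sup>-\<^sup>i\<^sup>t\<^sup>\<theta>\<close> and \<open>XY\<close> have means \<open>r\<^sup>s c\<^sub>s / 2\<close>, \<open>r\<^sup>t c\<^sub>t / 2\<close> and \<open>r\<^sup>s\<^sup>+\<^sup>t c\<^sub>s\<^sub>+\<^sub>t / 2\<close>. As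
  \<open>X\<close> and \<open>Y\<close> are unimodular, AM-GM bounds their covariance by \<open>1 - (|E X|\<^sup>2 + |E Y|\<^sup>2) / 2\<close>, hence by
  \<open>1 - |E X| |E Y|\<close>; let \<open>r\<close> tend to 1. Equality is attained by \<open>p = (1 + z\<^sup>q) / (1 - z\<^sup>q)\<close> with
  \<open>q = 1\<close> or \<open>q = s + t\<close>.
\<close>

section \<open>Covariance of two unimodular functions under a probability density\<close>

text \<open>Here \<open>z - x * y\<close> is the covariance of \<open>X\<close> and \<open>Y\<close>
  under \<open>W\<close>, so it is controlled by the two variances. A unimodular function has second
  moment 1, which makes these variances \<open>1 - |x|^2\<close> and
  \<open>1 - |y|^2\<close>.\<close>

lemma weighted_covariance_bound:
  fixes W :: "real \<Rightarrow> real" and X Y :: "real \<Rightarrow> complex"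
  assumes W: "(W has_integral 1) S" "\<And>t. t \<in> S \<Longrightarrow> W t \<ge> 0"
    and X: "((\<lambda>t. of_real (W t) * X t) has_integral x) S" "\<And>t. norm (X t) = 1"
    and Y: "((\<lambda>t. of_real (W t) * Y t) has_integral y) S" "\<And>t. norm (Y t) = 1"
    and XY: "((\<lambda>t. of_real (W t) * (X t * Y t)) has_integral z) S"
  shows "norm (z - x * y) + norm (x * y) \<le> 1"
proof -
  have W': "((\<lambda>t. of_real (W t) :: complex) has_integral 1) S"
    using has_integral_linear[OF W(1) bounded_linear_of_real] by (simp add: o_def)
  have sq: "(norm (u - v))\<^sup>2 = 1 + (norm v)\<^sup>2 - 2 * Re (cnj v * u)" if "norm u = 1" for u v :: complex
  proof -
    have "(Re u)\<^sup>2 + (Im u)\<^sup>2 = 1" using that by (metis cmod_power2 power_one)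
    then show ?thesis by (simp add: cmod_power2) (simp add: power2_eq_square algebra_simps)
  qed
  have part: "((\<lambda>t. W t * (norm (U t - u))\<^sup>2) has_integral 1 - (norm u)\<^sup>2) S"
    if U: "((\<lambda>t. of_real (W t) * U t) has_integral u) S" "\<And>t. norm (U t) = 1"
    for U :: "real \<Rightarrow> complex" and u
  proof -
    have "((\<lambda>t. Re (cnj u * (of_real (W t) * U t))) has_integral Re (cnj u * u)) S"
      using has_integral_linear[OF has_integral_mult_right[OF U(1), of "cnj u"] bounded_linear_Re]
      by (simp add: o_def)
    from has_integral_diff[OF has_integral_mult_right[OF W(1), of "1 + (norm u)\<^sup>2"]
        has_integral_mult_right[OF this, of 2]]
    have "((\<lambda>t. (1 + (norm u)\<^sup>2) * W t - 2 * Re (cnj u * (of_real (W t) * U t)))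
           has_integral (1 + (norm u)\<^sup>2) * 1 - 2 * Re (cnj u * u)) S" .
    moreover have "(1 + (norm u)\<^sup>2) * W t - 2 * Re (cnj u * (of_real (W t) * U t))
        = W t * (norm (U t - u))\<^sup>2" for t
      by (simp add: sq[OF U(2)] algebra_simps)
    moreover have "(1 + (norm u)\<^sup>2) * 1 - 2 * Re (cnj u * u) = 1 - (norm u)\<^sup>2"
      unfolding cmod_power2 by (simp add: power2_eq_square)
    ultimately show ?thesis by (simp only:)
  qed
  let ?c = "\<lambda>t. of_real (W t) * ((X t - x) * (Y t - y))"
  let ?b = "\<lambda>t. (1/2) * (W t * (norm (X t - x))\<^sup>2 + W t * (norm (Y t - y))\<^sup>2)"
  have b: "(?b has_integral (1/2) * ((1 - (norm x)\<^sup>2) + (1 - (norm y)\<^sup>2))) S"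
    by (intro has_integral_mult_right has_integral_add part X Y)
  \<comment> \<open>The expanded product \<open>(X - x) * (Y - y)\<close>, integrated term by
    term.\<close>
  have "((\<lambda>t. of_real (W t) * (X t * Y t) - y * (of_real (W t) * X t) - x * (of_real (W t) * Y t)
          + x * y * of_real (W t)) has_integral z - y * x - x * y + x * y * 1) S"
    by (intro has_integral_add has_integral_diff has_integral_mult_right X Y XY W')
  then have c: "(?c has_integral z - x * y) S"
    by (simp add: algebra_simps)
  have le: "norm (?c t) \<le> ?b t" if "t \<in> S" for t
  proof -
    have "norm (X t - x) * norm (Y t - y) \<le> ((norm (X t - x))\<^sup>2 + (norm (Y t - y))\<^sup>2) / 2"
      using sum_squares_bound[of "norm (X t - x)" "norm (Y t - y)"] by simp
    from mult_left_mono[OF this W(2)[OF that]]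
    have "W t * (norm (X t - x) * norm (Y t - y)) \<le> ?b t"
      by (simp add: distrib_left)
    then show ?thesis using W(2)[OF that] by (simp add: norm_mult)
  qed
  have "norm (z - x * y) \<le> (1/2) * ((1 - (norm x)\<^sup>2) + (1 - (norm y)\<^sup>2))"
    using integral_norm_bound_integral[OF has_integral_integrable[OF c] has_integral_integrable[OF b] le]
      integral_unique[OF c] integral_unique[OF b] by simp
  \<comment> \<open>AM-GM a second time, now on the means: \<open>|x| |y|\<close> is at most
    \<open>(|x|^2 + |y|^2) / 2\<close>, exactly what the variances leave over.\<close>
  then show ?thesis
    using sum_squares_bound[of "norm x" "norm y"] by (simp add: norm_mult)
qed

section \<open>Fourier coefficients on circles inside the disk\<close>

text \<open>Cauchy's formula for the \<open>l\<close>-th derivative at 0, written out in the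
  angle.\<close>

lemma circle_mean_coefficient:
  assumes holo: "p holomorphic_on ball 0 1" and r: "0 < r" "r < 1"
  shows "((\<lambda>t. p (of_real r * cis t) * cis (- (real l * t))) has_integral
           of_real (2 * pi * r ^ l) * fps_nth (fps_expansion p 0) l) {0..2*pi}"
proof -
  have "((\<lambda>u. p u / (u - 0) ^ Suc l) has_contour_integral
          (2 * pi * \<i>) / fact l * (deriv ^^ l) p 0) (circlepath 0 r)"
    by (rule Cauchy_has_contour_integral_higher_derivative_circlepath)
       (use r in \<open>auto intro!: holomorphic_on_imp_continuous_on holomorphic_on_subset[OF holo]\<close>)
  then have "((\<lambda>t. p (of_real r * cis t) / (of_real r * cis t) ^ Suc l * of_real r * \<i> * cis t)
          has_integral (2 * pi * \<i>) / fact l * (deriv ^^ l) p 0) {0..2*pi}"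
    by (simp add: circlepath_def has_contour_integral_part_circlepath_iff)
  \<comment> \<open>After \<open>dz = i z dt\<close> the integrand is \<open>i * p / z^l\<close>;
    this factor removes the \<open>i\<close> and the modulus of \<open>z^l\<close>.\<close>
  from has_integral_mult_right[OF this, of "of_real r ^ l / \<i>"]
  have "((\<lambda>t. of_real r ^ l / \<i> * (p (of_real r * cis t) / (of_real r * cis t) ^ Suc l * of_real r * \<i> * cis t))
          has_integral of_real (2 * pi * r ^ l) * fps_nth (fps_expansion p 0) l) {0..2*pi}"
    by (simp add: fps_expansion_def field_simps)
  moreover have "of_real r ^ l / \<i> * (p (of_real r * cis t) / (of_real r * cis t) ^ Suc l * of_real r * \<i> * cis t)
      = p (of_real r * cis t) * cis (- (real l * t))" for t
  proof -
    have "cis (- (real l * t)) = inverse (cis t ^ l)"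
      by (simp add: Complex.DeMoivre)
    then show ?thesis using r by (simp add: field_simps power_mult_distrib)
  qed
  ultimately show ?thesis by simp
qed

text \<open>A negative frequency amounts to the constant coefficient of \<open>p z * z ^ l\<close>,
  which vanishes at 0.\<close>

lemma circle_mean_coefficient_neg:
  assumes holo: "p holomorphic_on ball 0 1" and r: "0 < r" "r < 1" and l: "l > 0"
  shows "((\<lambda>t. p (of_real r * cis t) * cis (real l * t)) has_integral 0) {0..2*pi}"
proof -
  let ?q = "\<lambda>z. p z * z ^ l"
  have "?q holomorphic_on ball 0 1"
    by (intro holomorphic_intros holo)
  from circle_mean_coefficient[OF this r, of 0] l
  have "((\<lambda>t. p (of_real r * cis t) * (of_real r * cis t) ^ l) has_integral 0) {0..2*pi}"
    by (simp add: fps_expansion_def power_0_left)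
  from has_integral_mult_right[OF this, of "inverse (of_real r ^ l)"]
  have "((\<lambda>t. inverse (of_real r ^ l) * (p (of_real r * cis t) * (of_real r * cis t) ^ l)) has_integral 0) {0..2*pi}"
    by simp
  moreover have "inverse (of_real r ^ l) * (p (of_real r * cis t) * (of_real r * cis t) ^ l)
      = p (of_real r * cis t) * cis (real l * t)" for t
    using r by (simp add: power_mult_distrib Complex.DeMoivre field_simps)
  ultimately show ?thesis by simp
qed

text \<open>Write \<open>Re p\<close> as half of \<open>p + cnj p\<close>. The conjugate part has
  mean 0 at this frequency, which explains the factor 1/2; at \<open>l = 0\<close> it would
  contribute as well.\<close>

lemma circle_mean_Re:
  assumes holo: "p holomorphic_on ball 0 1" and r: "0 < r" "r < 1" and l: "l > 0"
  shows "((\<lambda>t. of_real (Re (p (of_real r * cis t)) / (2 * pi)) * cis (- (real l * t))) has_integral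
           of_real (r ^ l) * fps_nth (fps_expansion p 0) l / 2) {0..2*pi}"
proof -
  have "((\<lambda>t. cnj (p (of_real r * cis t) * cis (real l * t))) has_integral cnj 0) {0..2*pi}"
    using has_integral_linear[OF circle_mean_coefficient_neg[OF assms] bounded_linear_cnj]
    by (simp add: o_def)
  from has_integral_mult_right[OF has_integral_add[OF circle_mean_coefficient[OF holo r, of l] this],
      of "1 / (4 * of_real pi)"]
  have "((\<lambda>t. 1 / (4 * of_real pi) * (p (of_real r * cis t) * cis (- (real l * t)) +
           cnj (p (of_real r * cis t) * cis (real l * t)))) has_integral
           of_real (r ^ l) * fps_nth (fps_expansion p 0) l / 2) {0..2*pi}"
    by simp
  moreover have "1 / (4 * of_real pi) * (u * cis (- v) + cnj (u * cis v))
      = of_real (Re u / (2 * pi)) * cis (- v)" for u v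
  proof -
    have "u * cis (- v) + cnj (u * cis v) = (u + cnj u) * cis (- v)"
      by (simp add: cis_cnj algebra_simps)
    then show ?thesis by (simp add: complex_add_cnj)
  qed
  ultimately show ?thesis by simp
qed

section \<open>Coefficient inequality for functions with nonnegative real part\<close>

lemma Caratheodory_coefficient_bound:
  assumes holo: "p holomorphic_on ball 0 1" and p0: "p 0 = 1"
    and Re: "\<And>z. norm z < 1 \<Longrightarrow> z \<noteq> 0 \<Longrightarrow> Re (p z) \<ge> 0"
    and st: "s > 0" "t > 0"
  defines "c \<equiv> fps_nth (fps_expansion p 0)"
  shows "norm (c (s + t) - c s * c t / 2) + norm (c s * c t) / 2 \<le> 2"
proof -
  have *: "r ^ (s + t) * (norm (c (s + t) - c s * c t / 2) + norm (c s * c t) / 2) \<le> 2"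
    if r: "0 < r" "r < 1" for r
  proof -
    let ?W = "\<lambda>\<theta>. Re (p (of_real r * cis \<theta>)) / (2 * pi)"
    have "((\<lambda>\<theta>. Re (p (of_real r * cis \<theta>))) has_integral 2 * pi) {0..2*pi}"
      using has_integral_linear[OF circle_mean_coefficient[OF holo r, of 0] bounded_linear_Re] p0
      by (simp add: o_def fps_expansion_def)
    from has_integral_divide[OF this, of "2 * pi"]
    have W: "(?W has_integral 1) {0..2*pi}" by simp
    \<comment> \<open>The mean of \<open>XY\<close> and the product of the two means carry the same
      power \<open>r ^ (s + t)\<close>, so the radius factors out of the whole inequality.\<close>
    let ?A = "of_real (r ^ (s + t)) * c (s + t) / 2"
    let ?B = "of_real (r ^ s) * c s / 2 * (of_real (r ^ t) * c t / 2)"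
    have "norm (?A - ?B) + norm ?B \<le> 1"
    proof (rule weighted_covariance_bound[OF W, where X = "\<lambda>\<theta>. cis (- (real s * \<theta>))"
          and Y = "\<lambda>\<theta>. cis (- (real t * \<theta>))"])
      show "?W \<theta> \<ge> 0" for \<theta>
        using Re[of "of_real r * cis \<theta>"] r by (simp add: norm_mult)
      show "((\<lambda>\<theta>. of_real (?W \<theta>) * (cis (- (real s * \<theta>)) * cis (- (real t * \<theta>)))) has_integral
          of_real (r ^ (s + t)) * c (s + t) / 2) {0..2*pi}"
        using circle_mean_Re[OF holo r, of "s + t"] st by (simp add: c_def cis_mult algebra_simps)
    qed (use circle_mean_Re[OF holo r] st in \<open>auto simp: c_def\<close>)
    moreover have "?A - ?B = of_real (r ^ (s + t) / 2) * (c (s + t) - c s * c t / 2)"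
      by (simp add: power_add field_simps)
    moreover have "?B = of_real (r ^ (s + t) / 4) * (c s * c t)"
      by (simp add: power_add)
    moreover have "norm (of_real (r ^ (s + t) / a) * u) = r ^ (s + t) / a * norm u"
      if "a > 0" for a and u :: complex
      unfolding norm_mult norm_of_real using r that by simp
    ultimately have "r ^ (s + t) / 2 * norm (c (s + t) - c s * c t / 2)
        + r ^ (s + t) / 4 * norm (c s * c t) \<le> 1"
      by (simp only: zero_less_numeral)
    then show ?thesis by (simp add: distrib_left)
  qed
  \<comment> \<open>\<open>K\<close> does not depend on \<open>r\<close>, so letting
    \<open>r\<close> tend to 1 from the left only removes the factor
    \<open>r ^ (s + t)\<close>.\<close>
  define K where "K = norm (c (s + t) - c s * c t / 2) + norm (c s * c t) / 2"
  have "((\<lambda>r. r ^ (s + t) * K) \<longlongrightarrow> 1 ^ (s + t) * K) (at_left (1::real))"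
    by (intro tendsto_intros)
  moreover have "eventually (\<lambda>r. r ^ (s + t) * K \<le> 2) (at_left (1::real))"
    unfolding eventually_at_left_field using * by (intro exI[of _ 0]) (auto simp: K_def)
  ultimately have "1 ^ (s + t) * K \<le> 2"
    by (rule tendsto_upperbound) simp
  then show ?thesis by (simp add: K_def)
qed

section \<open>Power series of the transformed function\<close>

text \<open>The multiplier in \<open>z^n -> weight \<alpha> n * z^(n-1)\<close> under the operator
  \<open>f -> \<alpha> f/z + (1 - \<alpha>) f'\<close>.\<close>

definition weight :: "real \<Rightarrow> nat \<Rightarrow> real" where
  "weight \<alpha> n = \<alpha> + (1 - \<alpha>) * real n"

text \<open>The coefficient series of \<open>\<alpha> f(z)/z + (1 - \<alpha>) f'(z)\<close>, where \<open>F\<close> is that of \<open>f\<close> and \<open>f(0) = 0\<close>.\<close>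

definition weighted_shift :: "real \<Rightarrow> complex fps \<Rightarrow> complex fps" where
  "weighted_shift \<alpha> F = Abs_fps (\<lambda>n. of_real (weight \<alpha> (Suc n)) * fps_nth F (Suc n))"

lemma weight_ge_1: "weight \<alpha> n \<ge> 1" if "\<alpha> \<le> 1" "n \<ge> 1"
proof -
  have "0 \<le> (1 - \<alpha>) * (real n - 1)" using that by simp
  then show ?thesis by (simp add: weight_def algebra_simps)
qed

lemma weighted_shift_altdef:
  "weighted_shift \<alpha> F = fps_const (of_real \<alpha>) * fps_shift 1 F + fps_const (of_real (1 - \<alpha>)) * fps_deriv F"
  by (rule fps_ext) (simp add: weighted_shift_def weight_def algebra_simps)

lemma fps_conv_radius_const_mult_ge:
  "fps_conv_radius (fps_const c * F) \<ge> fps_conv_radius F" for c :: complex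
  using fps_conv_radius_mult[of "fps_const c" F] by simp

lemma fps_conv_radius_weighted_shift: "fps_conv_radius (weighted_shift \<alpha> F) \<ge> fps_conv_radius F"
proof -
  let ?A = "fps_const (of_real \<alpha>) * fps_shift 1 F" and ?B = "fps_const (of_real (1 - \<alpha>)) * fps_deriv F"
  have "fps_conv_radius ?A \<ge> fps_conv_radius F"
    using fps_conv_radius_const_mult_ge[of "fps_shift 1 F" "of_real \<alpha>"] by simp
  moreover have "fps_conv_radius ?B \<ge> fps_conv_radius F"
    using fps_conv_radius_const_mult_ge[of "fps_deriv F" "of_real (1 - \<alpha>)"] fps_conv_radius_deriv[of F]
    by (meson order_trans)
  ultimately show ?thesis
    using fps_conv_radius_add[of ?A ?B] unfolding weighted_shift_altdef
    by (meson min.boundedI order_trans)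
qed

lemma eval_weighted_shift:
  assumes F: "fps_conv_radius F \<ge> 1" "fps_nth F 0 = 0" and z: "norm z < 1" "z \<noteq> 0"
  shows "eval_fps (weighted_shift \<alpha> F) z =
           of_real \<alpha> * (eval_fps F z / z) + of_real (1 - \<alpha>) * deriv (eval_fps F) z"
proof -
  have zF: "ereal (norm z) < fps_conv_radius F"
    using F(1) z(1) by (meson ereal_less(3) less_le_trans)
  have zD: "ereal (norm z) < fps_conv_radius (fps_deriv F)"
    using zF fps_conv_radius_deriv by (rule less_le_trans)
  have lt: "ereal (norm z) < fps_conv_radius (fps_const c * G)"
    if "ereal (norm z) < fps_conv_radius G" for c :: complex and G
    using that fps_conv_radius_const_mult_ge by (rule less_le_trans)
  have sh: "eval_fps (fps_shift 1 F) z = eval_fps F z / z"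
  \<comment> \<open>The zero series has subdegree 0, so the shift rule, which needs subdegree at
    least 1, does not cover it.\<close>
  proof (cases "F = 0")
    case False
    then have "1 \<le> subdegree F" using F(2) by (intro subdegree_geI) auto
    then show ?thesis using eval_fps_shift[of 1 F z] zF z by simp
  qed auto
  have "eval_fps (weighted_shift \<alpha> F) z =
      eval_fps (fps_const (of_real \<alpha>) * fps_shift 1 F) z
      + eval_fps (fps_const (of_real (1 - \<alpha>)) * fps_deriv F) z"
    unfolding weighted_shift_altdef using zF zD by (intro eval_fps_add lt) auto
  also have "\<dots> = of_real \<alpha> * eval_fps (fps_shift 1 F) z + of_real (1 - \<alpha>) * eval_fps (fps_deriv F) z"
    using zF zD by (simp add: eval_fps_mult)
  also have "\<dots> = of_real \<alpha> * (eval_fps F z / z) + of_real (1 - \<alpha>) * deriv (eval_fps F) z"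
    by (simp only: sh eval_fps_deriv[OF zF])
  finally show ?thesis .
qed

text \<open>The Caratheodory bound is applied to the sum of the series
  \<open>weighted_shift\<close>, not to the expression with \<open>f z / z\<close>: the sum is
  holomorphic at 0 and has the value 1 there.\<close>

lemma class_A_alpha_coefficient_bound:
  assumes f: "f \<in> class_A_alpha \<alpha>" and st: "s > 0" "t > 0"
  defines "c \<equiv> \<lambda>n. of_real (weight \<alpha> (Suc n)) * taylor_coeff f (Suc n)"
  shows "norm (c (s + t) - c s * c t / 2) + norm (c s * c t) / 2 \<le> 2"
proof -
  let ?F = "fps_expansion f 0"
  let ?P = "weighted_shift \<alpha> ?F"
  have holo: "f holomorphic_on ball 0 1" and f0: "f 0 = 0" and f1: "deriv f 0 = 1"
    and pos: "\<And>z. norm z < 1 \<Longrightarrow> z \<noteq> 0 \<Longrightarrow>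
      Re (of_real \<alpha> * (f z / z) + of_real (1 - \<alpha>) * deriv f z) \<ge> 0"
    using f by (auto simp: class_A_alpha_def class_A_def)
  have F: "f has_fps_expansion ?F"
    by (rule has_fps_expansion_fps_expansion[OF _ _ holo]) auto
  have RF: "fps_conv_radius ?F \<ge> 1"
    using holomorphic_on_imp_fps_conv_radius_ge[OF F, of 1] holo by (simp add: one_ereal_def)
  have RP: "fps_conv_radius ?P \<ge> 1"
    using RF fps_conv_radius_weighted_shift by (rule order_trans)
  have ev: "eval_fps ?F z = f z" if "norm z < 1" for z
    using has_fps_expansion_imp_eval_fps_eq[OF F that holo] .
  have "eval_fps ?P holomorphic_on ball 0 1"
    using RP by (intro holomorphic_on_eval_fps) (auto simp: one_ereal_def ball_eball_mono)
  \<comment> \<open>The constant term is \<open>weight \<alpha> 1 * f'(0)\<close>, and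
    \<open>weight \<alpha> 1 = 1\<close>.\<close>
  moreover have "eval_fps ?P 0 = 1"
    using f1 by (simp add: eval_fps_at_0 weighted_shift_def weight_def fps_expansion_def)
  moreover have "Re (eval_fps ?P z) \<ge> 0" if z: "norm z < 1" "z \<noteq> 0" for z
  proof -
    have "deriv (eval_fps ?F) z = deriv f z"
    proof (rule deriv_cong_ev)
      have "eventually (\<lambda>w. w \<in> ball 0 1) (nhds z)"
        using z by (intro eventually_nhds_in_open) auto
      then show "eventually (\<lambda>w. eval_fps ?F w = f w) (nhds z)"
        by eventually_elim (auto intro: ev)
    qed simp
    then show ?thesis
      using eval_weighted_shift[OF RF _ z, of \<alpha>] pos[OF z] f0 ev[OF z(1)]
      by (simp add: fps_expansion_def)
  qed
  ultimately have "norm (fps_nth (fps_expansion (eval_fps ?P) 0) (s + t) -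
      fps_nth (fps_expansion (eval_fps ?P) 0) s * fps_nth (fps_expansion (eval_fps ?P) 0) t / 2)
    + norm (fps_nth (fps_expansion (eval_fps ?P) 0) s * fps_nth (fps_expansion (eval_fps ?P) 0) t) / 2 \<le> 2"
    using st by (intro Caratheodory_coefficient_bound)
  moreover have "fps_expansion (eval_fps ?P) 0 = ?P"
    using RP by (intro fps_expansion_eqI eval_fps_has_fps_expansion) (auto intro: less_le_trans[rotated])
  ultimately show ?thesis
    by (simp add: c_def weighted_shift_def)
qed

section \<open>Extremal functions\<close>

text \<open>For \<open>q > 0\<close> this is the expansion of \<open>(1 + z^q) / (1 - z^q)\<close>,
  given by coefficients so that they can be divided by the weights directly.\<close>

definition cayley_fps :: "nat \<Rightarrow> complex fps" where
  "cayley_fps q = Abs_fps (\<lambda>n. if n = 0 then 1 else if q dvd n then 2 else 0)"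

lemma fps_conv_radius_ge_1:
  fixes F :: "complex fps"
  assumes "\<And>n. norm (fps_nth F n) \<le> B"
  shows "fps_conv_radius F \<ge> 1"
  unfolding fps_conv_radius_def
proof (rule conv_radius_geI_ex')
  fix r :: real assume r: "0 < r" "ereal r < 1"
  show "summable (\<lambda>n. fps_nth F n * of_real r ^ n)"
  proof (rule summable_comparison_test')
    show "summable (\<lambda>n. B * r ^ n)"
      using r by (intro summable_mult summable_geometric) (simp add: one_ereal_def)
    show "norm (fps_nth F n * of_real r ^ n) \<le> B * r ^ n" for n
      using r assms[of n] by (simp add: norm_mult norm_power mult_right_mono)
  qed
qed

text \<open>Subtracting \<open>q\<close> preserves divisibility by \<open>q\<close>, so the
  coefficients at \<open>n\<close> and \<open>n - q\<close> cancel for \<open>n > q\<close>. What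
  survives is 1 at \<open>n = 0\<close> and \<open>2 - 1\<close> at \<open>n = q\<close>.\<close>

lemma cayley_fps_eq:
  assumes "q > 0"
  shows "cayley_fps q * (1 - fps_X ^ q) = 1 + fps_X ^ q"
proof (rule fps_ext)
  fix n
  have "fps_nth (cayley_fps q * (1 - fps_X ^ q)) n =
     fps_nth (cayley_fps q) n - (if n < q then 0 else fps_nth (cayley_fps q) (n - q))"
    by (simp add: algebra_simps fps_X_power_mult_right_nth)
  also have "\<dots> = fps_nth (1 + fps_X ^ q) n"
    using assms by (auto simp: cayley_fps_def dvd_minus_self dest: dvd_imp_le)
  finally show "fps_nth (cayley_fps q * (1 - fps_X ^ q)) n = fps_nth (1 + fps_X ^ q) n" .
qed

text \<open>With \<open>u = z^q\<close>, the real part of \<open>(1 + u) / (1 - u)\<close> has the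
  sign of \<open>Re ((1 + u) * cnj (1 - u)) = 1 - |u|^2\<close>.\<close>

lemma Re_eval_cayley_fps:
  assumes q: "q > 0" and z: "norm z < 1"
  shows "Re (eval_fps (cayley_fps q) z) \<ge> 0"
proof -
  let ?u = "z ^ q"
  have R: "fps_conv_radius (cayley_fps q) \<ge> 1"
    by (rule fps_conv_radius_ge_1[of _ 2]) (simp add: cayley_fps_def)
  have zR: "ereal (norm z) < fps_conv_radius (cayley_fps q)"
    using R z by (meson ereal_less(3) less_le_trans)
  have inf: "fps_conv_radius (1 - fps_X ^ q :: complex fps) = \<infinity>"
    using fps_conv_radius_diff[of 1 "fps_X ^ q :: complex fps"] by simp
  have "eval_fps (cayley_fps q * (1 - fps_X ^ q)) z = eval_fps (cayley_fps q) z * (1 - ?u)"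
    using zR inf by (simp add: eval_fps_mult eval_fps_diff)
  moreover have "eval_fps (cayley_fps q * (1 - fps_X ^ q)) z = 1 + ?u"
    unfolding cayley_fps_eq[OF q] by (simp add: eval_fps_add)
  ultimately have eq: "eval_fps (cayley_fps q) z * (1 - ?u) = 1 + ?u" by simp
  have u: "norm ?u < 1" using q z by (simp add: norm_power power_less_one_iff)
  then have "1 - ?u \<noteq> 0" by auto
  with eq have "eval_fps (cayley_fps q) z = (1 + ?u) / (1 - ?u)" by (simp add: field_simps)
  moreover have "Re ((1 + ?u) * cnj (1 - ?u)) = 1 - (norm ?u)\<^sup>2"
    unfolding cmod_power2 by (simp add: power2_eq_square algebra_simps del: complex_cnj_power)
  moreover have "(norm ?u)\<^sup>2 \<le> 1" using u by (simp add: power_le_one)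
  ultimately show ?thesis by (simp add: Re_complex_div_ge_0)
qed

text \<open>Dividing the coefficients of \<open>cayley_fps q\<close> by the weights inverts
  \<open>weighted_shift\<close>. As the weights are at least 1, the quotients stay bounded and the
  series converges on the disk.\<close>

lemma extremal_function:
  assumes \<alpha>: "\<alpha> \<le> 1" and q: "q > 0"
  obtains f where "f \<in> class_A_alpha \<alpha>"
    "\<And>n. n > 0 \<Longrightarrow> taylor_coeff f (Suc n) = (if q dvd n then 2 else 0) / of_real (weight \<alpha> (Suc n))"
proof -
  define F where "F = Abs_fps (\<lambda>n. if n = 0 then 0 else fps_nth (cayley_fps q) (n - 1) / of_real (weight \<alpha> n))"
  define f where "f = eval_fps F"
  have w: "weight \<alpha> (Suc n) \<ge> 1" for n using weight_ge_1[OF \<alpha>] by simp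
  have shift: "weighted_shift \<alpha> F = cayley_fps q"
  proof (rule fps_ext)
    show "fps_nth (weighted_shift \<alpha> F) n = fps_nth (cayley_fps q) n" for n
      using w[of n] by (simp add: weighted_shift_def F_def)
  qed
  have "norm (fps_nth F n) \<le> 2" for n
  proof (cases n)
    case (Suc j)
    have "norm (fps_nth (cayley_fps q) j) \<le> 2 * 1" by (simp add: cayley_fps_def)
    also have "\<dots> \<le> 2 * weight \<alpha> (Suc j)" using w[of j] by simp
    finally show ?thesis using w[of j] by (simp add: Suc F_def norm_divide field_simps)
  qed (simp add: F_def)
  then have R: "fps_conv_radius F \<ge> 1" by (rule fps_conv_radius_ge_1)
  have exp: "f has_fps_expansion F"
    unfolding f_def using R by (intro eval_fps_has_fps_expansion) (auto intro: less_le_trans[rotated])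
  have F0: "fps_nth F 0 = 0" by (simp add: F_def)
  have "f holomorphic_on ball 0 1" unfolding f_def
    using R by (intro holomorphic_on_eval_fps) (auto simp: one_ereal_def ball_eball_mono)
  moreover have "f 0 = 0" by (simp add: f_def eval_fps_at_0 F0)
  moreover have "deriv f 0 = 1"
    using fps_nth_fps_expansion[OF exp, of 1] by (simp add: F_def cayley_fps_def weight_def)
  moreover have "Re (of_real \<alpha> * (f z / z) + of_real (1 - \<alpha>) * deriv f z) \<ge> 0"
    if "norm z < 1" "z \<noteq> 0" for z
    using Re_eval_cayley_fps[OF q that(1)] eval_weighted_shift[OF R F0 that, of \<alpha>]
    unfolding shift f_def by simp
  ultimately have "f \<in> class_A_alpha \<alpha>"
    by (auto simp: class_A_alpha_def class_A_def)
  moreover have "taylor_coeff f (Suc n) = (if q dvd n then 2 else 0) / of_real (weight \<alpha> (Suc n))"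
    if "n > 0" for n
    using that by (simp add: fps_expansion_eqI[OF exp] F_def cayley_fps_def)
  ultimately show ?thesis by (rule that)
qed

section \<open>The three inequalities and their sharpness\<close>

theorem theorem6p1:
  fixes \<alpha> :: real and m k :: nat
  assumes "\<alpha> \<le> 1" and "2 \<le> k" and "k \<le> m - 1"
  shows "(\<forall>f \<in> class_A_alpha \<alpha>.
            norm (taylor_coeff f m -
                  of_real (Lambda \<alpha> m k) * taylor_coeff f k * taylor_coeff f (m - k + 1))
              + Lambda \<alpha> m k * norm (taylor_coeff f k * taylor_coeff f (m - k + 1))
            \<le> 2 / (\<alpha> + (1 - \<alpha>) * real m))
       \<and> (\<forall>f \<in> class_A_alpha \<alpha>.
            norm (taylor_coeff f m) \<le> 2 / (\<alpha> + (1 - \<alpha>) * real m))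
       \<and> (\<forall>f \<in> class_A_alpha \<alpha>. \<forall>\<nu> :: complex.
            norm (taylor_coeff f m - \<nu> * taylor_coeff f k * taylor_coeff f (m - k + 1))
            \<le> 2 / (\<alpha> + (1 - \<alpha>) * real m) * max 1 (norm (1 - \<nu> / of_real (Lambda \<alpha> m k))))
       \<and> (\<exists>f \<in> class_A_alpha \<alpha>.
            norm (taylor_coeff f m -
                  of_real (Lambda \<alpha> m k) * taylor_coeff f k * taylor_coeff f (m - k + 1))
              + Lambda \<alpha> m k * norm (taylor_coeff f k * taylor_coeff f (m - k + 1))
            = 2 / (\<alpha> + (1 - \<alpha>) * real m))
       \<and> (\<forall>\<nu> :: complex. \<exists>f \<in> class_A_alpha \<alpha>.
            norm (taylor_coeff f m - \<nu> * taylor_coeff f k * taylor_coeff f (m - k + 1))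
            = 2 / (\<alpha> + (1 - \<alpha>) * real m) * max 1 (norm (1 - \<nu> / of_real (Lambda \<alpha> m k))))"
proof -
  \<comment> \<open>The operator lowers degrees by one, so \<open>a_k\<close>,
    \<open>a_(m-k+1)\<close> and \<open>a_m\<close> belong to the indices \<open>s\<close>,
    \<open>t\<close> and \<open>s + t = m - 1\<close>.\<close>
  define s t where "s = k - 1" and "t = m - k"
  have st: "s > 0" "t > 0" and k: "k = Suc s" and mk: "m - k + 1 = Suc t" and m: "m = Suc (s + t)"
    using assms by (auto simp: s_def t_def)
  define x y w where "x = weight \<alpha> (Suc s)" and "y = weight \<alpha> (Suc t)" and "w = weight \<alpha> (Suc (s + t))"
  have pos: "x > 0" "y > 0" "w > 0"
    using weight_ge_1[OF assms(1)] by (auto simp: x_def y_def w_def intro: less_le_trans[of 0 1])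
  define L where "L = Lambda \<alpha> m k"
  \<comment> \<open>Thus \<open>c_s c_t / 2 = w L a_k a_(m-k+1)\<close> while
    \<open>c_(s+t) = w a_m\<close>: dividing the bound for the \<open>c_n\<close> by
    \<open>w\<close> produces exactly this constant.\<close>
  have L: "L = x * y / (2 * w)"
    unfolding L_def Lambda_def mk unfolding k m x_def y_def w_def weight_def by simp
  have Lpos: "L > 0" using pos by (simp add: L)
  have wm: "\<alpha> + (1 - \<alpha>) * real m = w"
    by (simp add: w_def weight_def m)
  have bound: "norm (a - of_real L * b * c) + L * norm (b * c) \<le> 2 / w"
    if "f \<in> class_A_alpha \<alpha>" and a: "a = taylor_coeff f m" and b: "b = taylor_coeff f k"
      and c: "c = taylor_coeff f (m - k + 1)" for f a b c
  proof -
    have "norm (of_real w * a - of_real x * b * (of_real y * c) / 2)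
        + norm (of_real x * b * (of_real y * c)) / 2 \<le> 2"
      using class_A_alpha_coefficient_bound[OF that(1) st]
      unfolding a b c mk unfolding k m x_def y_def w_def by simp
    moreover have "of_real w * a - of_real x * b * (of_real y * c) / 2 = of_real w * (a - of_real L * b * c)"
      using pos by (simp add: L field_simps)
    moreover have "of_real x * b * (of_real y * c) = of_real (2 * w * L) * (b * c)"
      using pos by (simp add: L field_simps)
    moreover have "norm (of_real v * u) = v * norm u" if "v > 0" for v and u :: complex
      using that by (simp add: norm_mult)
    moreover have "2 * w * L > 0" using pos Lpos by simp
    ultimately have "w * norm (a - of_real L * b * c) + 2 * w * L * norm (b * c) / 2 \<le> 2"
      using pos by (simp only:)
    then have "w * (norm (a - of_real L * b * c) + L * norm (b * c)) \<le> 2"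
      by (simp add: distrib_left)
    then show ?thesis using pos by (simp add: field_simps)
  qed
  have part3: "norm (a - \<nu> * b * c) \<le> 2 / w * max 1 (norm (1 - \<nu> / of_real L))"
    if "norm (a - of_real L * b * c) + L * norm (b * c) \<le> 2 / w" for a b c \<nu> :: complex
  proof -
    let ?M = "max 1 (norm (1 - \<nu> / of_real L))"
    \<comment> \<open>Splitting off \<open>L\<close> leaves the two terms of the first inequality
      with factors 1 and \<open>|1 - \<nu>/L|\<close>, both at most \<open>?M\<close>.\<close>
    have "a - \<nu> * b * c = (a - of_real L * b * c) + of_real L * (1 - \<nu> / of_real L) * (b * c)"
      using Lpos by (simp add: field_simps)
    then have "norm (a - \<nu> * b * c) \<le>
        norm (a - of_real L * b * c) + norm (of_real L * (1 - \<nu> / of_real L) * (b * c))"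
      by (metis norm_triangle_ineq)
    also have "norm (of_real L * (1 - \<nu> / of_real L) * (b * c))
        = norm (1 - \<nu> / of_real L) * (L * norm (b * c))"
      using Lpos by (simp add: norm_mult)
    also have "norm (a - of_real L * b * c) + norm (1 - \<nu> / of_real L) * (L * norm (b * c))
        \<le> ?M * norm (a - of_real L * b * c) + ?M * (L * norm (b * c))"
      using Lpos mult_right_mono[of 1 ?M "norm (a - of_real L * b * c)"]
      by (intro add_mono mult_right_mono) auto
    also have "\<dots> = ?M * (norm (a - of_real L * b * c) + L * norm (b * c))"
      by (simp add: algebra_simps)
    also have "\<dots> \<le> ?M * (2 / w)"
      using that by (intro mult_left_mono) auto
    finally show ?thesis by (simp add: mult.commute)
  qed
  \<comment> \<open>With \<open>q = 1\<close> all transformed coefficients of positive index equal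
    2.\<close>
  obtain f1 where f1: "f1 \<in> class_A_alpha \<alpha>" and
    "\<And>n. n > 0 \<Longrightarrow> taylor_coeff f1 (Suc n) = (if 1 dvd n then 2 else 0) / of_real (weight \<alpha> (Suc n))"
    using extremal_function[OF assms(1), of 1] by (metis zero_less_one)
  then have f1_coeff: "taylor_coeff f1 k = 2 / of_real x" "taylor_coeff f1 (m - k + 1) = 2 / of_real y"
    "taylor_coeff f1 m = 2 / of_real w"
    using st unfolding mk unfolding k m x_def y_def w_def by simp_all
  \<comment> \<open>With \<open>q = s + t\<close> the coefficient \<open>a_k\<close> vanishes while
    \<open>a_m\<close> stays at \<open>2 / w\<close>, so \<nu> drops out.\<close>
  obtain f2 where f2: "f2 \<in> class_A_alpha \<alpha>" and f2_coeff:
    "\<And>n. n > 0 \<Longrightarrow> taylor_coeff f2 (Suc n) = (if (s + t) dvd n then 2 else 0) / of_real (weight \<alpha> (Suc n))"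
    using extremal_function[OF assms(1), of "s + t"] st by (metis add_pos_pos)
  have "\<not> (s + t) dvd s" using st by (auto dest: dvd_imp_le)
  then have f2_k: "taylor_coeff f2 k = 0" and f2_m: "taylor_coeff f2 m = 2 / of_real w"
    using f2_coeff[of s] f2_coeff[of "s + t"] st by (simp_all add: k m w_def)
  \<comment> \<open>Since \<open>L * (2/x) * (2/y) = 2/w\<close>, the first norm is 0 and the second
    term alone gives the bound.\<close>
  have e1: "norm (2 / of_real w - of_real L * (2 / of_real x) * (2 / of_real y) :: complex)
      + L * norm (2 / of_real x * (2 / of_real y) :: complex) = 2 / w"
    using pos by (simp add: L norm_mult norm_divide)
  have e2: "norm (2 / of_real w - \<nu> * (2 / of_real x) * (2 / of_real y))
      = 2 / w * norm (1 - \<nu> / of_real L)" for \<nu> :: complex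
  proof -
    have "2 / of_real w - \<nu> * (2 / of_real x) * (2 / of_real y) = of_real (2 / w) * (1 - \<nu> / of_real L)"
      using pos by (simp add: L field_simps)
    then show ?thesis using pos by (simp only: norm_mult norm_of_real) simp
  qed
  have e3: "norm (2 / of_real w :: complex) = 2 / w"
    using pos by (simp add: norm_divide)
  have sharp1: "norm (taylor_coeff f1 m - of_real L * taylor_coeff f1 k * taylor_coeff f1 (m - k + 1))
      + L * norm (taylor_coeff f1 k * taylor_coeff f1 (m - k + 1)) = 2 / w"
    unfolding f1_coeff by (rule e1)
  have sharp: "\<exists>f\<in>class_A_alpha \<alpha>.
      norm (taylor_coeff f m - \<nu> * taylor_coeff f k * taylor_coeff f (m - k + 1))
      = 2 / w * max 1 (norm (1 - \<nu> / of_real L))" for \<nu>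
  \<comment> \<open>The maximum is attained by \<open>f1\<close> when \<open>|1 - \<nu>/L|\<close>
    dominates and by \<open>f2\<close> when 1 does.\<close>
  proof (cases "norm (1 - \<nu> / of_real L) \<ge> 1")
    case True
    then show ?thesis by (intro bexI[OF _ f1]) (simp only: f1_coeff e2 max_absorb2)
  next
    case False
    then show ?thesis by (intro bexI[OF _ f2]) (simp add: f2_k f2_m e3)
  qed
  have part2: "norm a \<le> 2 / w"
    if "norm (a - of_real L * b * c) + L * norm (b * c) \<le> 2 / w" for a b c :: complex
    \<comment> \<open>At \<open>\<nu> = 0\<close> the maximum equals 1.\<close>
    using part3[OF that, of 0] by simp
  show ?thesis
    unfolding wm L_def[symmetric]
  proof (intro conjI ballI allI)
    fix f and \<nu> :: complex
    assume "f \<in> class_A_alpha \<alpha>"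
    note b = bound[OF this refl refl refl]
    show "norm (taylor_coeff f m - of_real L * taylor_coeff f k * taylor_coeff f (m - k + 1))
        + L * norm (taylor_coeff f k * taylor_coeff f (m - k + 1)) \<le> 2 / w"
      by (rule b)
    show "norm (taylor_coeff f m) \<le> 2 / w"
      by (rule part2[OF b])
    show "norm (taylor_coeff f m - \<nu> * taylor_coeff f k * taylor_coeff f (m - k + 1))
        \<le> 2 / w * max 1 (norm (1 - \<nu> / of_real L))"
      by (rule part3[OF b])
  next
    show "\<exists>f\<in>class_A_alpha \<alpha>.
        norm (taylor_coeff f m - of_real L * taylor_coeff f k * taylor_coeff f (m - k + 1))
        + L * norm (taylor_coeff f k * taylor_coeff f (m - k + 1)) = 2 / w"
      using sharp1 f1 by (rule bexI)
  qed (rule sharp)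
qed

end
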